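(* Let $\mathcal{P}$ be an order-hereditary property of $k$-colourings with $\mathcal{P}_n\neq\emptyset$ for every $n\in\mathbb{N}$, and let $\varepsilon>0$ and $m\in\mathbb{N}$ be fixed. There exists $n_0$ such that for any $n\ge n_0$ there exists a collection $\mathcal{T}$ of $k$-colouring templates for $K_n$ satisfying: (i) $\mathcal{T}$ is a container family for $\mathcal{P}_n$; (ii) every template $t\in\mathcal{T}$ has entropy at most $(\pi(\mathcal{P})+\varepsilon)\binom n2$; (iii) for every realisation $c$ of a template in $\mathcal{T}$ there are at most $\varepsilon\binom nm$ subsets $A\subseteq[n]$ of size $m$ such that $c_{|A}\notin\mathcal{P}_m$; (iv) $|\mathcal{T}|\le k^{\varepsilon\binom n2}$.
   Context: $k\ge2$ is a fixed integer and $[k]=\{1,\dots,k\}$. $K_n$ is the complete graph on vertex set $[n]$. A $k$-colouring of $K_n$ is a function $c:E(K_n)\to[k]$. For $A=\{a_1<\dots<a_m\}\subseteq[n]$ the (order-preserving) restriction $c_{|A}$ is the $k$-colouring of $K_m$ given by $c_{|A}(ij)=c(a_ia_j)$. An order-hereditary property is a sequence $\mathcal{P}=(\mathcal{P}_n)_{n\in\mathbb{N}}$ where $\mathcal{P}_n$ is a set of $k$-colourings of $K_n$ and $c_{|A}\in\mathcal{P}_{|A|}$ whenever $c\in\mathcal{P}_n$ and $A\subseteq[n]$. A ($k$-colouring) template for $K_n$ is a function $t$ assigning to each edge $e$ a nonempty set $t(e)\subseteq[k]$. A realisation of $t$ is a $k$-colouring $c$ of $K_n$ with $c(e)\in t(e)$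 for all $e$; $\langle t\rangle$ is the set of realisations. The entropy is $\mathrm{Ent}(t)=\sum_{e}\log_k|t(e)|$. A container family for $\mathcal{P}_n$ is a collection $\mathcal{T}$ of templates for $K_n$ with $\mathcal{P}_n\subseteq\bigcup_{t\in\mathcal{T}}\langle t\rangle$. $\mathrm{ex}(n,\mathcal{P})=\max\{\mathrm{Ent}(t):\langle t\rangle\subseteq\mathcal{P}_n\}$ over templates $t$ for $K_n$, and $\pi(\mathcal{P})=\lim_{n\to\infty}\mathrm{ex}(n,\mathcal{P})/\binom n2$ (the limit exists). *)

theory Defs
  imports Complex_Main "HOL-Library.Ramsey" "HOL-Library.FuncSet"
begin

type_synonym colouring = "nat set \<Rightarrow> nat"
type_synonym template = "nat set \<Rightarrow> nat set"

definition edges :: "nat \<Rightarrow> nat set set" where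
  "edges n = nsets {1..n} 2"

text \<open>
  Colourings and templates are extensional functions (undefined off the edge set), so
  that equality of functions is equality on edges and the sets below are finite.
\<close>

definition colourings :: "nat \<Rightarrow> nat \<Rightarrow> colouring set" where
  "colourings k n = edges n \<rightarrow>\<^sub>E {1..k}"

text \<open>The \<open>i\<close>-th smallest element of the finite set \<open>A\<close>, counting from \<open>1\<close>.\<close>

definition nth_smallest :: "nat set \<Rightarrow> nat \<Rightarrow> nat" where
  "nth_smallest A i = sorted_list_of_set A ! (i - 1)"

definition restr :: "colouring \<Rightarrow> nat set \<Rightarrow> colouring" where
  "restr c A = restrict (\<lambda>e. c (nth_smallest A ` e)) (edges (card A))"

definition order_hereditary :: "nat \<Rightarrow> (nat \<Rightarrow> colouring set) \<Rightarrow> bool" where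
  "order_hereditary k P \<longleftrightarrow>
     (\<forall>n. P n \<subseteq> colourings k n) \<and>
     (\<forall>n. \<forall>c\<in>P n. \<forall>A\<subseteq>{1..n}. restr c A \<in> P (card A))"

definition templates :: "nat \<Rightarrow> nat \<Rightarrow> template set" where
  "templates k n = edges n \<rightarrow>\<^sub>E {S. S \<subseteq> {1..k} \<and> S \<noteq> {}}"

definition realisations :: "nat \<Rightarrow> nat \<Rightarrow> template \<Rightarrow> colouring set" where
  "realisations k n t = {c \<in> colourings k n. \<forall>e\<in>edges n. c e \<in> t e}"

definition Ent :: "nat \<Rightarrow> nat \<Rightarrow> template \<Rightarrow> real" where
  "Ent k n t = (\<Sum>e\<in>edges n. log (real k) (real (card (t e))))"

definition container_family ::
    "nat \<Rightarrow> nat \<Rightarrow> (nat \<Rightarrow> colouring set) \<Rightarrow> template set \<Rightarrow> bool" where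
  "container_family k n P T \<longleftrightarrow>
     T \<subseteq> templates k n \<and> P n \<subseteq> (\<Union>t\<in>T. realisations k n t)"

text \<open>
  The maximum is over a finite set, which is nonempty whenever \<open>P n\<close> contains a
  colouring (take the template of singletons).
\<close>

definition extremal_entropy :: "nat \<Rightarrow> nat \<Rightarrow> (nat \<Rightarrow> colouring set) \<Rightarrow> real" where
  "extremal_entropy k n P =
     Max {Ent k n t | t. t \<in> templates k n \<and> realisations k n t \<subseteq> P n}"

definition entropy_density :: "nat \<Rightarrow> (nat \<Rightarrow> colouring set) \<Rightarrow> real" where
  "entropy_density k P = lim (\<lambda>n. extremal_entropy k n P / real (n choose 2))"

end

theory Submission
  imports Defs
begin

text \<open>
  Fix a large \<open>N\<close> and call an \<open>N\<close>-set bad for a template \<open>t\<close> if \<open>t\<close> allows a colouring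
  outside \<open>P N\<close> on it. Averaging over \<open>N\<close>-sets shows that a template with few bad sets
  satisfies the entropy bound and the supersaturation bound, so it suffices to cover \<open>P n\<close>
  by few templates with few bad sets.

  Let \<open>c \<in> P n\<close> realise a template \<open>t\<close> with many bad sets. Many of these are copies of one
  colouring \<open>x\<close> outside \<open>P N\<close>. Force the colours of \<open>c\<close> to agree with \<open>x\<close> on one pair of \<open>[N]\<close>
  after the other: no copy survives, so at some pair \<open>q\<close> the number of surviving copies drops
  by a large factor. Averaging over the \<open>N - 2\<close> vertices \<open>B\<close> of a copy not on \<open>q\<close> gives one \<open>B\<close>
  for which the set \<open>D\<close> of edges completing \<open>B\<close> to a surviving copy is dense, while few
  edges of \<open>D\<close> have colour \<open>x q\<close> in \<open>c\<close>. Every other pair of the copy meets \<open>B\<close>, so \<open>D\<close> is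
  determined by \<open>t\<close> and the colours of \<open>c\<close> on the \<open>O(n)\<close> edges meeting \<open>B\<close>. Deleting the colour
  \<open>x q\<close> on \<open>D\<close>, except on the small exceptional set, therefore shrinks \<open>t\<close> by about
  \<open>card D\<close> at the cost of few choices. Iterating, the number of templates is
  bounded by \<open>exp (\<mu> * weight n t)\<close> for the initial template \<open>t\<close>, with \<open>\<mu>\<close> arbitrarily small.
\<close>

subsection \<open>Order-preserving restriction\<close>

lemma nth_smallest_bij:
  assumes "finite A"
  shows "bij_betw (nth_smallest A) {1..card A} A"
proof -
  have "bij_betw (\<lambda>i. i - 1) {1..card A} {..<card A}"
    by (rule bij_betw_byWitness[where f' = Suc]) auto
  moreover have "bij_betw ((!) (sorted_list_of_set A)) {..<card A} A"
    using assms by (intro bij_betw_nth) auto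
  ultimately have "bij_betw ((!) (sorted_list_of_set A) \<circ> (\<lambda>i. i - 1)) {1..card A} A"
    by (rule bij_betw_trans)
  then show ?thesis
    by (simp add: comp_def nth_smallest_def[abs_def])
qed

text \<open>\<open>nth_smallest A\<close> is increasing on \<open>{1..card A}\<close>, so it maps
  the sorted list of \<open>B\<close> entrywise to the sorted list of the image.\<close>

lemma nth_smallest_image:
  assumes "finite A" "B \<subseteq> {1..card A}" "i \<in> {1..card B}"
  shows "nth_smallest (nth_smallest A ` B) i = nth_smallest A (nth_smallest B i)"
proof -
  have B: "finite B" using assms(2) finite_subset by blast
  let ?L = "sorted_list_of_set B"
  have mono: "nth_smallest A x \<le> nth_smallest A y" if "x \<in> B" "y \<in> B" "x \<le> y" for x y
    using that assms unfolding nth_smallest_def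
    by (intro sorted_nth_mono) (auto simp: subset_iff)
  have inj: "inj_on (nth_smallest A) B"
    using nth_smallest_bij[OF assms(1)] assms(2) by (meson bij_betw_def inj_on_subset)
  have "sorted (map (nth_smallest A) ?L)"
    unfolding sorted_map using sorted_sorted_list_of_set[of B]
    by (rule sorted_wrt_mono_rel[rotated]) (use B mono in auto)
  moreover have "distinct (map (nth_smallest A) ?L)"
    using inj B by (simp add: distinct_map)
  ultimately have "sorted_list_of_set (nth_smallest A ` B) = map (nth_smallest A) ?L"
    using B by (metis list.set_map set_sorted_list_of_set sorted_list_of_set.idem_if_sorted_distinct)
  moreover have "i - 1 < length ?L" using assms(3) by auto
  ultimately show ?thesis
    by (simp add: nth_smallest_def)
qed

lemma nth_smallest_image_nsets:
  assumes "finite A"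
  shows "bij_betw ((`) (nth_smallest A)) (edges (card A)) (nsets A 2)"
  unfolding edges_def using nth_smallest_bij[OF assms] by (rule bij_betw_nsets)

text \<open>\<open>B\<close> is the preimage of \<open>M\<close> under the order isomorphism from
  \<open>{1..N}\<close> to \<open>A\<close>. This lets heredity be applied inside
  \<open>restr c A\<close>.\<close>

lemma restr_restr:
  assumes A: "A \<in> nsets {1..n} N" and M: "M \<subseteq> A"
  obtains B where "B \<subseteq> {1..N}" "card B = card M" "restr (restr c A) B = restr c M"
proof -
  have fA: "finite A" "card A = N" using A by (auto simp: nsets_def)
  obtain B where B: "B \<subseteq> {1..N}" "nth_smallest A ` B = M"
    using nth_smallest_bij[OF fA(1)] M fA by (metis bij_betw_def subset_imageE)
  have inj: "inj_on (nth_smallest A) {1..N}"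
    using nth_smallest_bij[OF fA(1)] fA by (simp add: bij_betw_def)
  have card: "card B = card M"
    using B inj card_image inj_on_subset by metis
  have fB: "finite B" using B(1) finite_subset by blast
  have "restr (restr c A) B e = restr c M e" for e
  proof (cases "e \<in> edges (card B)")
    case True
    then have e: "e \<subseteq> {1..card B}" by (auto simp: edges_def nsets_def)
    have "nth_smallest B ` e \<in> nsets B 2"
      using nth_smallest_image_nsets[OF fB] True by (auto simp: bij_betw_def)
    then have "nth_smallest B ` e \<in> edges N"
      using B(1) nsets_mono unfolding edges_def by blast
    moreover have "nth_smallest M i = nth_smallest A (nth_smallest B i)" if "i \<in> e" for i
      using nth_smallest_image[of A B i] B fA e that by blast
    then have "nth_smallest M ` e = nth_smallest A ` nth_smallest B ` e"
      by (auto simp: image_image)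
    ultimately show ?thesis
      using True card fA by (simp add: restr_def)
  qed (simp add: restr_def card)
  then show thesis using that B(1) card by blast
qed

section \<open>Double counting of nested subsets\<close>

lemma card_nsets_containing:
  assumes "finite V" "E \<subseteq> V" "card E \<le> N"
  shows "card {A \<in> nsets V N. E \<subseteq> A} = (card V - card E) choose (N - card E)"
proof -
  have fE: "finite E" using assms finite_subset by blast
  have "bij_betw (\<lambda>B. B \<union> E) (nsets (V - E) (N - card E)) {A \<in> nsets V N. E \<subseteq> A}"
  proof (rule bij_betw_byWitness[where f' = "\<lambda>A. A - E"])
    show "(\<lambda>B. B \<union> E) ` nsets (V - E) (N - card E) \<subseteq> {A \<in> nsets V N. E \<subseteq> A}"
    proof clarify
      fix B assume B: "B \<in> nsets (V - E) (N - card E)"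
      then have "card (B \<union> E) = card B + card E"
        using fE by (intro card_Un_disjoint) (auto simp: nsets_def)
      then show "B \<union> E \<in> nsets V N \<and> E \<subseteq> B \<union> E"
        using B assms fE by (auto simp: nsets_def)
    qed
  qed (use fE in \<open>auto simp: nsets_def card_Diff_subset\<close>)
  then have "card {A \<in> nsets V N. E \<subseteq> A} = card (nsets (V - E) (N - card E))"
    by (rule bij_betw_same_card[symmetric])
  then show ?thesis using assms fE by (simp add: card_Diff_subset)
qed

text \<open>Exchange the sums: each \<open>m\<close>-set lies in the same number of
  \<open>N\<close>-sets. It is used with edge entropies (\<open>m = 2\<close>) and with the
  indicator of a bad restriction.\<close>

lemma sum_nsets_nsets:
  fixes f :: "'a set \<Rightarrow> real"
  assumes "finite V" "m \<le> N"
  shows "(\<Sum>A\<in>nsets V N. \<Sum>E\<in>nsets A m. f E)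
    = real ((card V - m) choose (N - m)) * (\<Sum>E\<in>nsets V m. f E)"
proof -
  have "(\<Sum>A\<in>nsets V N. \<Sum>E\<in>nsets A m. f E) = (\<Sum>A\<in>nsets V N. \<Sum>E\<in>{E \<in> nsets V m. E \<subseteq> A}. f E)"
    by (rule sum.cong) (auto simp: nsets_def intro!: sum.cong)
  also have "\<dots> = (\<Sum>E\<in>nsets V m. \<Sum>A\<in>{A \<in> nsets V N. E \<subseteq> A}. f E)"
    using assms by (intro sum.swap_restrict finite_imp_finite_nsets)
  also have "\<dots> = (\<Sum>E\<in>nsets V m. real ((card V - m) choose (N - m)) * f E)"
  proof (intro sum.cong refl)
    fix E assume "E \<in> nsets V m"
    then have "card {A \<in> nsets V N. E \<subseteq> A} = (card V - m) choose (N - m)"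
      using assms card_nsets_containing[of V E N] by (auto simp: nsets_def)
    then show "(\<Sum>A\<in>{A \<in> nsets V N. E \<subseteq> A}. f E) = real ((card V - m) choose (N - m)) * f E"
      by simp
  qed
  finally show ?thesis by (simp add: sum_distrib_left)
qed

subsection \<open>Entropy and averaging\<close>

lemma finite_edges [simp]: "finite (edges n)"
  by (simp add: edges_def finite_imp_finite_nsets)

lemma card_edges [simp]: "card (edges n) = n choose 2"
  by (simp add: edges_def)

lemma finite_colourings [simp]: "finite (colourings k n)"
  by (simp add: colourings_def finite_PiE)

lemma finite_templates [simp]: "finite (templates k n)"
  by (simp add: templates_def finite_PiE)

lemma template_edge:
  assumes "t \<in> templates k n" "e \<in> edges n"
  shows "t e \<subseteq> {1..k}" "t e \<noteq> {}" "finite (t e)" "1 \<le> card (t e)" "card (t e) \<le> k"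
proof -
  show *: "t e \<subseteq> {1..k}" "t e \<noteq> {}"
    using assms by (auto simp: templates_def)
  then show fin: "finite (t e)" using finite_subset by blast
  show "1 \<le> card (t e)" using * fin by (simp add: Suc_le_eq card_gt_0_iff)
  show "card (t e) \<le> k" using card_mono[OF _ *(1)] by simp
qed

lemma Ent_nonneg:
  assumes "2 \<le> k" "t \<in> templates k n"
  shows "0 \<le> Ent k n t"
  unfolding Ent_def
proof (rule sum_nonneg)
  fix e assume "e \<in> edges n"
  then show "0 \<le> log (real k) (real (card (t e)))"
    using assms(1) template_edge(4)[OF assms(2)] by fastforce
qed

lemma Ent_le_choose:
  assumes "2 \<le> k" "t \<in> templates k n"
  shows "Ent k n t \<le> real (n choose 2)"
proof -
  have "log (real k) (real (card (t e))) \<le> 1" if "e \<in> edges n" for e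
    using assms template_edge(4,5)[OF assms(2) that] by simp
  then have "Ent k n t \<le> real (card (edges n)) * 1"
    unfolding Ent_def by (rule sum_bounded_above)
  then show ?thesis by simp
qed

lemma Ent_set_finite: "finite {Ent k n t | t. t \<in> templates k n \<and> realisations k n t \<subseteq> P n}"
  by (rule finite_surj[of "templates k n" _ "Ent k n"]) auto

lemma Ent_le_extremal:
  assumes "t \<in> templates k n" "realisations k n t \<subseteq> P n"
  shows "Ent k n t \<le> extremal_entropy k n P"
  unfolding extremal_entropy_def using assms by (intro Max_ge Ent_set_finite) blast

text \<open>The template of singletons \<open>{c e}\<close> has \<open>c\<close> as its only
  realisation, so the \<open>Max\<close> is taken over a nonempty set and is attained.\<close>

lemma extremal_entropy_attained:
  assumes "c \<in> P n" "c \<in> colourings k n"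
  obtains t where "t \<in> templates k n" "realisations k n t \<subseteq> P n" "Ent k n t = extremal_entropy k n P"
proof -
  define t where "t = restrict (\<lambda>e. {c e}) (edges n)"
  have t: "t \<in> templates k n" using assms(2) by (auto simp: t_def templates_def colourings_def)
  have "x = c" if "x \<in> realisations k n t" for x
    using that assms(2) unfolding realisations_def colourings_def t_def
    by (auto intro!: PiE_ext[of x "edges n" _ c])
  then have "realisations k n t \<subseteq> P n" using assms(1) by blast
  with t have "{Ent k n t | t. t \<in> templates k n \<and> realisations k n t \<subseteq> P n} \<noteq> {}" by blast
  then show thesis
    using Max_in[OF Ent_set_finite[of k n P]] that[unfolded extremal_entropy_def] by auto
qed

lemma extremal_entropy_nonneg:
  assumes "2 \<le> k" "P n \<subseteq> colourings k n" "P n \<noteq> {}"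
  shows "0 \<le> extremal_entropy k n P"
proof -
  obtain c where "c \<in> P n" "c \<in> colourings k n" using assms by blast
  then obtain t where "t \<in> templates k n" "Ent k n t = extremal_entropy k n P"
    by (rule extremal_entropy_attained)
  then show ?thesis using Ent_nonneg[OF assms(1)] by metis
qed

section \<open>Templates seen on \<open>N\<close>-sets, and bad copies\<close>

definition pullback :: "template \<Rightarrow> nat set \<Rightarrow> template" where
  "pullback t A = restrict (\<lambda>e. t (nth_smallest A ` e)) (edges (card A))"

text \<open>Equivalently, \<open>pullback t A\<close> has a realisation outside \<open>P N\<close>.
  Writing the forbidden colouring \<open>x\<close> explicitly prepares for the pigeonhole over
  \<open>x\<close>.\<close>

definition bad_copies :: "nat \<Rightarrow> (nat \<Rightarrow> colouring set) \<Rightarrow> nat \<Rightarrow> nat \<Rightarrow> template \<Rightarrow> nat set set" where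
  "bad_copies k P N n t =
     {A \<in> nsets {1..n} N. \<exists>x\<in>colourings k N - P N. \<forall>p\<in>edges N. x p \<in> t (nth_smallest A ` p)}"

lemma nsetsD:
  assumes "A \<in> nsets {1..n} N"
  shows "finite A" "card A = N" "A \<subseteq> {1..n}"
  using assms by (auto simp: nsets_def)

lemma nth_smallest_edge:
  assumes "A \<in> nsets {1..n} N" "p \<in> edges N"
  shows "nth_smallest A ` p \<in> nsets A 2" "nth_smallest A ` p \<in> edges n"
proof -
  show *: "nth_smallest A ` p \<in> nsets A 2"
    using nth_smallest_image_nsets[of A] nsetsD[OF assms(1)] assms(2) by (auto simp: bij_betw_def)
  show "nth_smallest A ` p \<in> edges n"
    using * nsets_mono[OF nsetsD(3)[OF assms(1)]] unfolding edges_def by blast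
qed

lemma pullback_template:
  assumes "A \<in> nsets {1..n} N" "t \<in> templates k n"
  shows "pullback t A \<in> templates k N"
  using nth_smallest_edge(2)[OF assms(1)] nsetsD[OF assms(1)] assms(2)
  by (force simp: pullback_def templates_def)

lemma restr_colouring:
  assumes "A \<in> nsets {1..n} N" "c \<in> colourings k n"
  shows "restr c A \<in> colourings k N"
  using nth_smallest_edge(2)[OF assms(1)] nsetsD[OF assms(1)] assms(2)
  by (force simp: restr_def colourings_def)

lemma restr_apply:
  assumes "A \<in> nsets {1..n} N" "p \<in> edges N"
  shows "restr c A p = c (nth_smallest A ` p)"
  using nsetsD[OF assms(1)] assms(2) by (simp add: restr_def)

lemma Ent_pullback:
  assumes "A \<in> nsets {1..n} N"
  shows "Ent k N (pullback t A) = (\<Sum>e\<in>nsets A 2. log (real k) (real (card (t e))))"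
  using sum.reindex_bij_betw[OF nth_smallest_image_nsets[of A],
      of "\<lambda>e. log (real k) (real (card (t e)))"] nsetsD[OF assms]
  by (simp add: Ent_def pullback_def)

lemma choose_swap:
  assumes "m \<le> N" "N \<le> n"
  shows "real (n choose N) * real (N choose m) = real (n choose m) * real ((n - m) choose (N - m))"
  using choose_mult[OF assms] by (metis of_nat_mult)

text \<open>\<open>Ent k n t\<close> is a multiple of the sum of the entropies of the pullbacks to
  all \<open>N\<close>-sets. A good set contributes at most the extremal entropy at
  \<open>N\<close>, and the bad sets together raise the density by at most \<delta>.\<close>

lemma Ent_averaging:
  assumes k: "2 \<le> k" and P: "P N \<subseteq> colourings k N" "P N \<noteq> {}"
    and t: "t \<in> templates k n" and N: "2 \<le> N" "N \<le> n"
    and bad: "real (card (bad_copies k P N n t)) \<le> \<delta> * real (n choose N)"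
  shows "Ent k n t \<le> (extremal_entropy k N P / real (N choose 2) + \<delta>) * real (n choose 2)"
proof -
  let ?B = "bad_copies k P N n t" and ?X = "extremal_entropy k N P" and ?c = "real (N choose 2)"
  have pos: "?c > 0" "real ((n - 2) choose (N - 2)) > 0"
    using N by (auto simp: zero_less_binomial_iff)
  have X0: "0 \<le> ?X" using extremal_entropy_nonneg[of k P N] k P by simp
  \<comment> \<open>On a bad set the trivial bound \<open>?c\<close> is enough; adding the
    nonnegative \<open>?X\<close> makes both cases uniform.\<close>
  have le: "Ent k N (pullback t A) \<le> ?X + (if A \<in> ?B then ?c else 0)" if A: "A \<in> nsets {1..n} N" for A
  proof (cases "A \<in> ?B")
    case True
    then show ?thesis
      using X0 Ent_le_choose[OF k pullback_template[OF A t]] by simp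
  next
    case False
    have "realisations k N (pullback t A) \<subseteq> P N"
      using False A nsetsD(2)[OF A] by (auto simp: bad_copies_def realisations_def pullback_def)
    then show ?thesis
      using False Ent_le_extremal[OF pullback_template[OF A t]] by simp
  qed
  have "real ((n - 2) choose (N - 2)) * Ent k n t = (\<Sum>A\<in>nsets {1..n} N. Ent k N (pullback t A))"
    using sum_nsets_nsets[of "{1..n}" 2 N "\<lambda>e. log (real k) (real (card (t e)))"] N
    by (simp add: Ent_pullback cong: sum.cong) (simp add: Ent_def edges_def)
  also have "\<dots> \<le> (\<Sum>A\<in>nsets {1..n} N. ?X + (if A \<in> ?B then ?c else 0))"
    by (rule sum_mono) (rule le)
  also have "\<dots> = real (n choose N) * ?X + (\<Sum>A\<in>nsets {1..n} N. if A \<in> ?B then ?c else 0)"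
    by (simp add: sum.distrib)
  also have "(\<Sum>A\<in>nsets {1..n} N. if A \<in> ?B then ?c else 0) = (\<Sum>A\<in>?B. ?c)"
    by (rule sum.mono_neutral_cong_right) (auto simp: finite_imp_finite_nsets bad_copies_def)
  also have "\<dots> = real (card ?B) * ?c" by simp
  also have "\<dots> \<le> (\<delta> * real (n choose N)) * ?c"
    using bad by (rule mult_right_mono) simp
  also have "real (n choose N) * ?X + (\<delta> * real (n choose N)) * ?c
      = real (n choose N) * ?c * (?X / ?c + \<delta>)"
    using pos by (simp add: field_simps)
  also have "\<dots> = real (n choose 2) * real ((n - 2) choose (N - 2)) * (?X / ?c + \<delta>)"
    by (simp only: choose_swap[OF N])
  finally have "real ((n - 2) choose (N - 2)) * Ent k n t
      \<le> real ((n - 2) choose (N - 2)) * ((?X / ?c + \<delta>) * real (n choose 2))"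
    by (simp add: algebra_simps)
  then show ?thesis using pos by simp
qed

text \<open>By heredity, an \<open>m\<close>-set whose restriction is outside \<open>P m\<close>
  makes every \<open>N\<close>-set containing it bad. Hence only bad sets contribute to the double
  count, each at most \<open>N choose m\<close>.\<close>

lemma card_bad_restr_le:
  assumes oh: "order_hereditary k P" and N: "m \<le> N" "N \<le> n" and c: "c \<in> realisations k n t"
    and bad: "real (card (bad_copies k P N n t)) \<le> \<delta> * real (n choose N)"
  shows "real (card {A \<in> nsets {1..n} m. restr c A \<notin> P m}) \<le> \<delta> * real (n choose m)"
proof -
  let ?B = "bad_copies k P N n t" and ?M = "{A \<in> nsets {1..n} m. restr c A \<notin> P m}"
  let ?f = "\<lambda>E. if restr c E \<notin> P m then 1 else 0 :: real"
  have c': "c \<in> colourings k n" and ct: "\<And>e. e \<in> edges n \<Longrightarrow> c e \<in> t e"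
    using c by (auto simp: realisations_def)
  have pos: "real ((n - m) choose (N - m)) > 0"
    using N by (auto simp: zero_less_binomial_iff)
  have inB: "A \<in> ?B" if A: "A \<in> nsets {1..n} N" and E: "E \<in> nsets A m" "restr c E \<notin> P m" for A E
  proof -
    have "restr c A \<notin> P N"
    proof
      assume "restr c A \<in> P N"
      moreover have E': "E \<subseteq> A" "card E = m" using E by (auto simp: nsets_def)
      obtain B where "B \<subseteq> {1..N}" "card B = m" "restr (restr c A) B = restr c E"
        using restr_restr[OF A E'(1)] E'(2) by metis
      ultimately have "restr c E \<in> P m"
        using oh unfolding order_hereditary_def by metis
      then show False using E by simp
    qed
    then show ?thesis
      using restr_colouring[OF A c'] A ct restr_apply[OF A] nth_smallest_edge(2)[OF A]
      unfolding bad_copies_def by (auto intro!: bexI[of _ "restr c A"])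
  qed
  have "real (card ?M) = (\<Sum>E\<in>nsets {1..n} m. ?f E)"
    by (simp add: sum.If_cases finite_imp_finite_nsets Int_def)
  then have "real ((n - m) choose (N - m)) * real (card ?M)
      = (\<Sum>A\<in>nsets {1..n} N. \<Sum>E\<in>nsets A m. ?f E)"
    using sum_nsets_nsets[of "{1..n}" m N ?f] N by simp
  also have "\<dots> = (\<Sum>A\<in>?B. \<Sum>E\<in>nsets A m. ?f E)"
  proof (rule sum.mono_neutral_right)
    show "\<forall>A\<in>nsets {1..n} N - ?B. (\<Sum>E\<in>nsets A m. ?f E) = 0"
      using inB by (intro ballI sum.neutral) auto
  qed (auto simp: finite_imp_finite_nsets bad_copies_def)
  also have "\<dots> \<le> (\<Sum>A\<in>?B. real (N choose m))"
  proof (rule sum_mono)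
    fix A assume "A \<in> ?B"
    then have "card A = N" by (auto simp: bad_copies_def nsets_def)
    then show "(\<Sum>E\<in>nsets A m. ?f E) \<le> real (N choose m)"
      using sum_bounded_above[of "nsets A m" ?f 1] by simp
  qed
  also have "\<dots> \<le> \<delta> * real (n choose N) * real (N choose m)"
    using bad by (simp add: mult_right_mono)
  also have "\<dots> = real ((n - m) choose (N - m)) * (\<delta> * real (n choose m))"
    using choose_swap[OF N] by (simp add: algebra_simps)
  finally show ?thesis using pos by simp
qed

text \<open>A forbidden colouring allowed by \<open>t\<close> on some \<open>A\<close> would extend
  to a realisation of \<open>t\<close>, hence to a member of \<open>P n\<close>, against
  heredity.\<close>

lemma no_bad_copies:
  assumes t: "t \<in> templates k n" and sub: "realisations k n t \<subseteq> P n" and oh: "order_hereditary k P"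
  shows "bad_copies k P N n t = {}"
proof (rule ccontr)
  assume "bad_copies k P N n t \<noteq> {}"
  then obtain A x where A: "A \<in> nsets {1..n} N" and x: "x \<in> colourings k N" "x \<notin> P N"
    and xt: "\<And>p. p \<in> edges N \<Longrightarrow> x p \<in> t (nth_smallest A ` p)"
    by (auto simp: bad_copies_def)
  have bij: "bij_betw ((`) (nth_smallest A)) (edges N) (nsets A 2)"
    using nth_smallest_image_nsets nsetsD[OF A] by blast
  \<comment> \<open>\<open>g\<close> returns an edge inside \<open>A\<close> to its position in
    \<open>edges N\<close>. The colouring \<open>c\<close> copies \<open>x\<close> onto
    \<open>A\<close> and takes an arbitrary allowed colour elsewhere.\<close>
  define g where "g = inv_into (edges N) ((`) (nth_smallest A))"
  define c where "c = restrict (\<lambda>e. if e \<in> nsets A 2 then x (g e) else SOME i. i \<in> t e) (edges n)"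
  have ct: "c e \<in> t e" if e: "e \<in> edges n" for e
  proof (cases "e \<in> nsets A 2")
    case True
    then have "g e \<in> edges N" "nth_smallest A ` g e = e"
      using bij unfolding g_def
      by (metis bij_betw_imp_surj_on inv_into_into, metis bij_betw_imp_surj_on f_inv_into_f)
    then show ?thesis using xt[of "g e"] True e by (simp add: c_def)
  next
    case False
    then show ?thesis
      using e template_edge(2)[OF t e] by (simp add: c_def some_in_eq)
  qed
  then have "c \<in> colourings k n"
    using template_edge(1)[OF t] unfolding colourings_def by (auto simp: c_def PiE_def extensional_def)
  with ct have "c \<in> P n" using sub by (auto simp: realisations_def)
  then have "restr c A \<in> P N"
    using oh nsetsD[OF A] unfolding order_hereditary_def by blast
  moreover have "restr c A = x"
  proof (rule PiE_ext[of _ "edges N" _ x])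
    show "restr c A \<in> edges N \<rightarrow>\<^sub>E {1..k}"
      using restr_colouring[OF A \<open>c \<in> colourings k n\<close>] by (simp add: colourings_def)
    show "x \<in> edges N \<rightarrow>\<^sub>E {1..k}" using x by (simp add: colourings_def)
    fix p assume p: "p \<in> edges N"
    then have "g (nth_smallest A ` p) = p"
      using bij by (simp add: g_def bij_betw_def)
    then show "restr c A p = x p"
      using restr_apply[OF A p] nth_smallest_edge[OF A p] by (simp add: c_def)
  qed
  ultimately show False using x by simp
qed

section \<open>Monotonicity and convergence of the entropy density\<close>

text \<open>An optimal template for \<open>n\<close> has no bad \<open>N\<close>-sets, so averaging
  applies with \<delta> equal to 0.\<close>

lemma extremal_density_le:
  assumes k: "2 \<le> k" and oh: "order_hereditary k P" and ne: "\<And>n. P n \<noteq> {}" and N: "2 \<le> N" "N \<le> n"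
  shows "extremal_entropy k n P / real (n choose 2) \<le> extremal_entropy k N P / real (N choose 2)"
proof -
  have P: "P j \<subseteq> colourings k j" for j using oh by (simp add: order_hereditary_def)
  obtain c where "c \<in> P n" "c \<in> colourings k n" using P ne by blast
  then obtain t where t: "t \<in> templates k n" "realisations k n t \<subseteq> P n"
    and ent: "Ent k n t = extremal_entropy k n P"
    by (rule extremal_entropy_attained)
  have "Ent k n t \<le> (extremal_entropy k N P / real (N choose 2) + 0) * real (n choose 2)"
    by (rule Ent_averaging[of k P N t n 0, OF k P ne t(1) N]) (simp add: no_bad_copies[OF t oh])
  moreover have "real (n choose 2) > 0" using N by (auto simp: zero_less_binomial_iff)
  ultimately show ?thesis using ent by (simp add: divide_le_eq)
qed

lemma extremal_density_tendsto:
  assumes k: "2 \<le> k" and oh: "order_hereditary k P" and ne: "\<And>n. P n \<noteq> {}"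
  shows "(\<lambda>n. extremal_entropy k n P / real (n choose 2)) \<longlonglongrightarrow> entropy_density k P"
proof -
  let ?f = "\<lambda>n. extremal_entropy k n P / real (n choose 2)"
  have "0 \<le> extremal_entropy k n P" for n
    using oh by (intro extremal_entropy_nonneg[OF k _ ne]) (simp add: order_hereditary_def)
  \<comment> \<open>The shift by 2 skips the indices where \<open>n choose 2\<close> vanishes; from
    there on the density is decreasing and bounded below.\<close>
  then have "0 \<le> ?f (n + 2)" for n by (intro divide_nonneg_nonneg) auto
  moreover have "decseq (\<lambda>n. ?f (n + 2))"
    by (intro decseq_SucI extremal_density_le[OF k oh ne]) auto
  ultimately obtain L where "(\<lambda>n. ?f (n + 2)) \<longlonglongrightarrow> L"
    using decseq_convergent[of "\<lambda>n. ?f (n + 2)" 0] by blast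
  then have "convergent (\<lambda>n. ?f (n + 2))" by (rule convergentI)
  then have "convergent ?f" by (rule convergent_ignore_initial_segment[THEN iffD1])
  then show ?thesis
    unfolding entropy_density_def by (simp add: convergent_LIMSEQ_iff)
qed

subsection \<open>Fingerprints\<close>

lemma sum_power_card_Pow:
  fixes z :: real
  assumes "finite D"
  shows "(\<Sum>S\<in>Pow D. z ^ card S) = (1 + z) ^ card D"
  using assms
proof (induction D rule: finite_induct)
  case (insert a D)
  have inj: "inj_on (insert a) (Pow D)" using insert by (auto simp: inj_on_def)
  have "(\<Sum>S\<in>insert a ` Pow D. z ^ card S) = (\<Sum>S\<in>Pow D. z ^ card (insert a S))"
    using inj by (simp add: sum.reindex)
  also have "\<dots> = (\<Sum>S\<in>Pow D. z * z ^ card S)"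
  proof (rule sum.cong)
    fix S assume "S \<in> Pow D"
    then have "finite S" "a \<notin> S" using insert finite_subset by auto
    then show "z ^ card (insert a S) = z * z ^ card S" by simp
  qed simp
  also have "\<dots> = z * (1 + z) ^ card D"
    using insert by (simp add: sum_distrib_left[symmetric])
  finally have *: "(\<Sum>S\<in>insert a ` Pow D. z ^ card S) = z * (1 + z) ^ card D" .
  have "Pow D \<inter> insert a ` Pow D = {}" using insert by auto
  then show ?case
    using insert * by (simp add: Pow_insert sum.union_disjoint algebra_simps)
qed simp

text \<open>Chernoff-type count: each small \<open>S\<close> contributes at least \<open>z powr (\<gamma> * card D)\<close> to the
  sum \<open>(1 + z) ^ card D\<close>, where \<open>z = exp (- L)\<close>.\<close>

lemma few_small_subsets:
  assumes "0 < \<eta>"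
  obtains \<gamma> :: real where "0 < \<gamma>" "\<gamma> \<le> 1/2"
    "\<And>D :: 'a set. finite D \<Longrightarrow>
       real (card {S. S \<subseteq> D \<and> real (card S) \<le> \<gamma> * real (card D)}) \<le> exp (\<eta> * real (card D))"
proof -
  \<comment> \<open>The final exponent is \<open>exp (- L) + \<gamma> * L\<close>, and each summand
    is made at most \<open>\<eta>/2\<close>. The cap \<open>1/2\<close> on \<gamma> later ensures
    that at least half of \<open>D\<close> loses a colour.\<close>
  define L where "L = max 1 (ln (2/\<eta>))"
  define \<gamma> where "\<gamma> = min (1/2) (\<eta> / (2 * L))"
  have L: "L \<ge> 1" "exp (- L) \<le> \<eta>/2"
  proof -
    show "L \<ge> 1" by (simp add: L_def)
    have "exp (- L) \<le> exp (- ln (2/\<eta>))" by (simp add: L_def)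
    also have "\<dots> = \<eta>/2" using assms by (simp add: exp_minus)
    finally show "exp (- L) \<le> \<eta>/2" .
  qed
  have "\<gamma> \<le> \<eta> / (2 * L)" by (simp add: \<gamma>_def)
  then have \<gamma>L: "\<gamma> * L \<le> \<eta>/2" using L by (simp add: field_simps)
  show thesis
  proof
    show "0 < \<gamma>" "\<gamma> \<le> 1/2" using assms L by (auto simp: \<gamma>_def)
    fix D :: "'a set" assume D: "finite D"
    let ?d = "real (card D)"
    let ?F = "{S. S \<subseteq> D \<and> real (card S) \<le> \<gamma> * ?d}"
    have "real (card ?F) * exp (- (\<gamma> * L * ?d)) = (\<Sum>S\<in>?F. exp (- (\<gamma> * L * ?d)))" by simp
    also have "\<dots> \<le> (\<Sum>S\<in>?F. exp (- L) ^ card S)"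
    proof (rule sum_mono)
      fix S assume "S \<in> ?F"
      then have "L * real (card S) \<le> L * (\<gamma> * ?d)" using L by (intro mult_left_mono) auto
      then show "exp (- (\<gamma> * L * ?d)) \<le> exp (- L) ^ card S"
        by (simp add: exp_of_nat_mult[symmetric] algebra_simps)
    qed
    also have "\<dots> \<le> (\<Sum>S\<in>Pow D. exp (- L) ^ card S)"
      using D by (intro sum_mono2) auto
    also have "\<dots> = (1 + exp (- L)) ^ card D" by (rule sum_power_card_Pow[OF D])
    also have "\<dots> \<le> exp (exp (- L)) ^ card D"
      by (intro power_mono exp_ge_add_one_self) (simp add: add_nonneg_nonneg)
    also have "\<dots> = exp (exp (- L) * ?d)" by (simp add: exp_of_nat_mult[symmetric] mult.commute)
    finally have "real (card ?F) \<le> exp (exp (- L) * ?d) * exp (\<gamma> * L * ?d)"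
      by (simp add: exp_minus field_simps)
    also have "\<dots> = exp ((exp (- L) + \<gamma> * L) * ?d)" by (simp add: exp_add[symmetric] algebra_simps)
    also have "\<dots> \<le> exp (\<eta> * ?d)"
      using L \<gamma>L by (intro exp_le_cancel_iff[THEN iffD2] mult_right_mono) auto
    finally show "real (card ?F) \<le> exp (\<eta> * ?d)" .
  qed
qed

section \<open>Forcing copies pair by pair, and links\<close>

text \<open>Without such a drop, induction would give \<open>a r \<ge> \<rho> ^ r * a 0 > 0\<close>.
  The second bound says that many copies still survive just before the drop.\<close>

lemma first_large_drop:
  fixes a :: "nat \<Rightarrow> real"
  assumes "a 0 > 0" "a r = 0" "\<rho> > 0"
  obtains j where "j < r" "a (Suc j) \<le> \<rho> * a j" "\<rho> ^ j * a 0 \<le> a j"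
proof -
  have "\<exists>j<r. a (Suc j) \<le> \<rho> * a j \<and> \<rho> ^ j * a 0 \<le> a j"
  proof (rule ccontr)
    assume neg: "\<not> ?thesis"
    have "j \<le> r \<Longrightarrow> \<rho> ^ j * a 0 \<le> a j" for j
    proof (induction j)
      case (Suc j)
      then have IH: "\<rho> ^ j * a 0 \<le> a j" and "j < r" by auto
      then have "\<rho> * a j < a (Suc j)" using neg by force
      moreover have "\<rho> * (\<rho> ^ j * a 0) \<le> \<rho> * a j" using IH assms by simp
      ultimately show ?case by simp
    qed simp
    then have "\<rho> ^ r * a 0 \<le> 0" using assms(2) by force
    moreover have "0 < \<rho> ^ r * a 0" using assms by simp
    ultimately show False by simp
  qed
  then show thesis using that by blast
qed

text \<open>\<open>Q\<close> is the set of pairs on which \<open>c\<close> has already been forced to agree with \<open>x\<close>.\<close>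

definition partial_copies :: "nat \<Rightarrow> nat \<Rightarrow> template \<Rightarrow> colouring \<Rightarrow> nat set set \<Rightarrow> colouring \<Rightarrow> nat set set" where
  "partial_copies N n t x Q c =
     {A \<in> nsets {1..n} N. (\<forall>p\<in>edges N. x p \<in> t (nth_smallest A ` p)) \<and>
                          (\<forall>p\<in>Q. c (nth_smallest A ` p) = x p)}"

text \<open>The link of \<open>B\<close> in the \<open>N\<close>-uniform hypergraph of surviving
  copies, limited to those copies whose two vertices outside \<open>B\<close> occupy position
  \<open>q\<close>.\<close>

definition link :: "nat \<Rightarrow> nat \<Rightarrow> template \<Rightarrow> colouring \<Rightarrow> nat set set \<Rightarrow> nat set \<Rightarrow> nat set \<Rightarrow> colouring \<Rightarrow> nat set set" where
  "link N n t x Q q B c =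
     {e \<in> edges n. e \<inter> B = {} \<and> e \<union> B \<in> partial_copies N n t x Q c \<and> nth_smallest (e \<union> B) ` q = e}"

lemma finite_partial_copies: "finite (partial_copies N n t x Q c)"
  by (simp add: partial_copies_def finite_imp_finite_nsets)

lemma finite_link: "finite (link N n t x Q q B c)"
  by (simp add: link_def)

text \<open>Guarantees that deleting \<open>x q\<close> on link edges really removes an available
  colour.\<close>

lemma link_colour:
  assumes "e \<in> link N n t x Q q B c" "q \<in> edges N"
  shows "x q \<in> t e"
  using assms by (fastforce simp: link_def partial_copies_def)

text \<open>A copy splits uniquely into its pair in position \<open>q\<close> and the remaining
  \<open>N - 2\<close> vertices. Taking for \<open>R\<close> the test \<open>c e = x q\<close>
  counts the copies that survive when \<open>q\<close> is forced too.\<close>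

lemma sum_card_link:
  assumes N: "2 \<le> N" and q: "q \<in> edges N"
  shows "(\<Sum>B\<in>nsets {1..n} (N - 2). card {e \<in> link N n t x Q q B c. R e})
    = card {A \<in> partial_copies N n t x Q c. R (nth_smallest A ` q)}"
proof -
  let ?P = "{A \<in> partial_copies N n t x Q c. R (nth_smallest A ` q)}"
  let ?S = "SIGMA B:nsets {1..n} (N - 2). {e \<in> link N n t x Q q B c. R e}"
  let ?f = "\<lambda>A. (A - nth_smallest A ` q, nth_smallest A ` q)" and ?g = "\<lambda>(B, e). e \<union> B"
  have "bij_betw ?f ?P ?S"
  proof (rule bij_betw_byWitness[where f' = ?g])
    have *: "nth_smallest A ` q \<subseteq> A" "nth_smallest A ` q \<in> edges n"
      "A - nth_smallest A ` q \<in> nsets {1..n} (N - 2)" if "A \<in> nsets {1..n} N" for A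
    proof -
      have e: "nth_smallest A ` q \<in> nsets A 2" "nth_smallest A ` q \<in> edges n"
        using nth_smallest_edge[OF that q] by auto
      then show "nth_smallest A ` q \<subseteq> A" "nth_smallest A ` q \<in> edges n" by (auto simp: nsets_def)
      show "A - nth_smallest A ` q \<in> nsets {1..n} (N - 2)"
        using e(1) nsetsD[OF that] by (auto simp: nsets_def card_Diff_subset)
    qed
    then have U: "nth_smallest A ` q \<union> (A - nth_smallest A ` q) = A" if "A \<in> nsets {1..n} N" for A
      using that by blast
    show "\<forall>A\<in>?P. ?g (?f A) = A"
      using U by (simp add: partial_copies_def)
    show "\<forall>Be\<in>?S. ?f (?g Be) = Be"
      by (auto simp: link_def)
    show "?f ` ?P \<subseteq> ?S"
    proof (rule image_subsetI)
      fix A assume "A \<in> ?P"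
      then have A: "A \<in> partial_copies N n t x Q c" and R: "R (nth_smallest A ` q)" by auto
      then have A': "A \<in> nsets {1..n} N" by (simp add: partial_copies_def)
      show "?f A \<in> ?S"
        using *[OF A'] U[OF A'] A R unfolding link_def by auto
    qed
    show "?g ` ?S \<subseteq> ?P"
      by (auto simp: link_def)
  qed
  then have "card ?P = card ?S" by (rule bij_betw_same_card)
  also have "\<dots> = (\<Sum>B\<in>nsets {1..n} (N - 2). card {e \<in> link N n t x Q q B c. R e})"
    by (intro card_SigmaI) (auto simp: finite_imp_finite_nsets finite_link)
  finally show ?thesis by simp
qed

text \<open>In a copy \<open>e \<union> B\<close> the only pair missing \<open>B\<close> is
  \<open>e\<close>, which sits at \<open>q\<close>. As \<open>q\<close> is not in \<open>Q\<close>,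
  the forced positions only look up colours of \<open>c\<close> on edges meeting
  \<open>B\<close>.\<close>

lemma link_determined:
  assumes q: "q \<in> edges N" "q \<notin> Q" "Q \<subseteq> edges N"
  shows "link N n t x Q q B (restrict c {e \<in> edges n. e \<inter> B \<noteq> {}}) = link N n t x Q q B c"
proof -
  define y where "y = restrict c {e \<in> edges n. e \<inter> B \<noteq> {}}"
  have *: "y (nth_smallest (e \<union> B) ` p) = c (nth_smallest (e \<union> B) ` p)"
    if A: "e \<union> B \<in> nsets {1..n} N" and e: "e \<in> edges n" "nth_smallest (e \<union> B) ` q = e" and p: "p \<in> Q" for e p
  proof -
    let ?f = "nth_smallest (e \<union> B) ` p"
    have pN: "p \<in> edges N" "p \<noteq> q" using p q by auto
    have "?f \<noteq> e"
      using nth_smallest_image_nsets[OF nsetsD(1)[OF A]] nsetsD(2)[OF A] pN q e(2)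
      by (metis bij_betw_imp_inj_on inj_on_contraD)
    moreover have f: "?f \<in> nsets (e \<union> B) 2" "?f \<in> edges n"
      using nth_smallest_edge[OF A pN(1)] by auto
    moreover have "card e = 2" "finite e" using e by (auto simp: edges_def nsets_def)
    ultimately have "\<not> ?f \<subseteq> e"
      using card_subset_eq[of e ?f] by (auto simp: nsets_def)
    then have "?f \<inter> B \<noteq> {}" using f by (auto simp: nsets_def)
    then show ?thesis using f by (simp add: y_def)
  qed
  have "e \<union> B \<in> partial_copies N n t x Q y \<longleftrightarrow> e \<union> B \<in> partial_copies N n t x Q c"
    if "e \<in> edges n" "nth_smallest (e \<union> B) ` q = e" for e
    using *[OF _ that] by (auto simp: partial_copies_def)
  then show ?thesis
    unfolding link_def y_def[symmetric] by blast
qed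

text \<open>Pigeonhole: each bad set is a copy of some forbidden \<open>x\<close>, with no pair
  forced yet.\<close>

lemma exists_common_colouring:
  assumes b: "b \<ge> 0" and bad: "real (card (bad_copies k P N n t)) > b"
  shows "\<exists>x\<in>colourings k N - P N. real (card (partial_copies N n t x {} c)) > b / real (card (colourings k N))"
proof (rule ccontr)
  let ?Z = "colourings k N - P N" and ?M = "real (card (colourings k N))"
  assume neg: "\<not> ?thesis"
  have "bad_copies k P N n t \<subseteq> (\<Union>x\<in>?Z. partial_copies N n t x {} c)"
    by (auto simp: bad_copies_def partial_copies_def)
  then have "card (bad_copies k P N n t) \<le> card (\<Union>x\<in>?Z. partial_copies N n t x {} c)"
    by (intro card_mono) (auto simp: finite_partial_copies)
  also have "\<dots> \<le> (\<Sum>x\<in>?Z. card (partial_copies N n t x {} c))"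
    by (rule card_UN_le) simp
  finally have "real (card (bad_copies k P N n t)) \<le> (\<Sum>x\<in>?Z. real (card (partial_copies N n t x {} c)))"
    by (metis of_nat_le_iff of_nat_sum)
  also have "\<dots> \<le> real (card ?Z) * (b / ?M)"
    using neg by (intro sum_bounded_above) (auto simp: not_less)
  also have "\<dots> \<le> ?M * (b / ?M)"
    using b by (intro mult_right_mono) (auto intro: card_mono)
  also have "\<dots> \<le> b" using b by simp
  finally show False using bad by simp
qed

text \<open>A copy with all pairs forced would give \<open>restr c A = x\<close>, while heredity
  puts \<open>restr c A\<close> in \<open>P N\<close>. So the sequence of copy counts ends at
  0.\<close>

lemma partial_copies_all_empty:
  assumes oh: "order_hereditary k P" and c: "c \<in> P n" and x: "x \<in> colourings k N" "x \<notin> P N"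
  shows "partial_copies N n t x (edges N) c = {}"
proof (rule ccontr)
  assume "partial_copies N n t x (edges N) c \<noteq> {}"
  then obtain A where A: "A \<in> nsets {1..n} N" and eq: "\<And>p. p \<in> edges N \<Longrightarrow> c (nth_smallest A ` p) = x p"
    by (auto simp: partial_copies_def)
  have "c \<in> colourings k n" and "restr c A \<in> P N"
    using oh c nsetsD[OF A] unfolding order_hereditary_def by blast+
  moreover have "restr c A = x"
    using restr_colouring[OF A \<open>c \<in> colourings k n\<close>] x(1) restr_apply[OF A] eq
    unfolding colourings_def by (auto intro!: PiE_ext[of _ "edges N" _ x])
  ultimately show False using x by simp
qed

text \<open>At the first large drop, few copies have colour \<open>x q\<close> on their pair at
  \<open>q\<close>. Averaging over \<open>B\<close> finds one link that is both dense and mostly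
  free of that colour.\<close>

lemma fingerprint_exists:
  assumes oh: "order_hereditary k P" and c: "c \<in> P n" and N: "2 \<le> N" "N \<le> n" and \<delta>: "\<delta> > 0"
    and \<gamma>: "0 < \<gamma>" "\<gamma> \<le> 1/2"
    and bad: "real (card (bad_copies k P N n t)) > \<delta> * real (n choose N)"
  obtains x Q q B where "x \<in> colourings k N" "Q \<subseteq> edges N" "q \<in> edges N" "q \<notin> Q"
    "B \<in> nsets {1..n} (N - 2)"
    "\<delta> / real (card (colourings k N)) * (\<gamma>/2) ^ (N choose 2) / 2 * (real ((n - N + 2) choose 2) / real (N choose 2))
      \<le> real (card (link N n t x Q q B c))"
    "real (card {e \<in> link N n t x Q q B c. c e = x q}) \<le> \<gamma> * real (card (link N n t x Q q B c))"
proof -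
  let ?C = "real (n choose N)" and ?M = "real (card (colourings k N))" and ?r = "N choose 2"
    and ?K = "real (n choose (N - 2))"
  \<comment> \<open>Half of \<gamma> pays for the edges of colour \<open>x q\<close>; the other half
    remains as a lower bound on the link size.\<close>
  define \<rho> where "\<rho> = \<gamma>/2"
  have \<rho>: "0 < \<rho>" "\<rho> \<le> 1" using \<gamma> by (auto simp: \<rho>_def)
  have b0: "\<delta> * ?C \<ge> 0" using \<delta> by simp
  obtain x where x: "x \<in> colourings k N" "x \<notin> P N"
    and large: "real (card (partial_copies N n t x {} c)) > \<delta> * ?C / ?M"
    using exists_common_colouring[OF b0 bad] by blast
  \<comment> \<open>Any order of the pairs will do; \<open>Q\<close> will be an initial segment and
    \<open>q\<close> the next pair.\<close>
  obtain ps where ps: "set ps = edges N" "distinct ps"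
    using finite_distinct_list[OF finite_edges] by blast
  have len: "length ps = ?r" using ps distinct_card[of ps] by simp
  define a where "a j = real (card (partial_copies N n t x (set (take j ps)) c))" for j
  have "a 0 > 0" using large b0 unfolding a_def
    by (smt (verit) divide_nonneg_nonneg of_nat_0_le_iff set_empty2 take_0)
  moreover have "a ?r = 0"
    using partial_copies_all_empty[OF oh c x] ps len by (simp add: a_def)
  ultimately obtain j where j: "j < ?r" and drop: "a (Suc j) \<le> \<rho> * a j" and aj: "\<rho> ^ j * a 0 \<le> a j"
    using \<rho> first_large_drop[of a ?r \<rho>] by blast
  define Q where "Q = set (take j ps)"
  define q where "q = ps ! j"
  have Q: "Q \<subseteq> edges N" using ps set_take_subset unfolding Q_def by metis
  have q: "q \<in> edges N" using ps j len nth_mem unfolding q_def by metis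
  have SucQ: "set (take (Suc j) ps) = insert q Q"
    using j len by (simp add: take_Suc_conv_app_nth Q_def q_def)
  have "distinct (take (Suc j) ps)" using ps by simp
  then have qQ: "q \<notin> Q" using j len by (simp add: take_Suc_conv_app_nth Q_def q_def)
  let ?D = "\<lambda>B. link N n t x Q q B c"
  let ?S = "\<lambda>B. {e \<in> ?D B. c e = x q}"
  let ?N = "nsets {1..n} (N - 2)"
  have K0: "?K > 0" using N by (simp add: zero_less_binomial_iff)
  have sumD: "(\<Sum>B\<in>?N. real (card (?D B))) = a j"
    using sum_card_link[OF N(1) q, of n t x Q c "\<lambda>_. True"]
    by (simp add: a_def Q_def of_nat_sum[symmetric] del: of_nat_sum)
  have "{A \<in> partial_copies N n t x Q c. c (nth_smallest A ` q) = x q} = partial_copies N n t x (insert q Q) c"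
    by (auto simp: partial_copies_def)
  then have sumS: "(\<Sum>B\<in>?N. real (card (?S B))) = a (Suc j)"
    using sum_card_link[OF N(1) q, of n t x Q c "\<lambda>e. c e = x q"] SucQ
    by (simp add: a_def of_nat_sum[symmetric] del: of_nat_sum)
  \<comment> \<open>Averaging the difference yields both conclusions for the same \<open>B\<close>:
    its nonnegativity bounds \<open>?S B\<close>, and its size bounds \<open>?D B\<close> from
    below. The sum over all \<open>B\<close> is \<open>\<gamma> * a j - a (Suc j)\<close>, at least
    \<open>\<rho> * a j\<close>.\<close>
  have "\<exists>B\<in>?N. \<rho> * a j / ?K \<le> \<gamma> * real (card (?D B)) - real (card (?S B))"
  proof (rule ccontr)
    assume "\<not> ?thesis"
    then have lt: "\<gamma> * real (card (?D B)) - real (card (?S B)) < \<rho> * a j / ?K" if "B \<in> ?N" for B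
      using that by force
    have ne: "finite ?N" "?N \<noteq> {}"
      using N by (auto simp: finite_imp_finite_nsets nsets_eq_empty_iff)
    have "(\<Sum>B\<in>?N. \<gamma> * real (card (?D B)) - real (card (?S B))) < (\<Sum>B\<in>?N. \<rho> * a j / ?K)"
      by (rule sum_strict_mono[OF ne]) (rule lt)
    also have "\<dots> = \<rho> * a j" using K0 by simp
    finally have "\<gamma> * a j - a (Suc j) < \<rho> * a j"
      by (simp only: sum_subtractf sum_distrib_left[symmetric] sumD sumS)
    then show False using drop by (simp add: \<rho>_def field_simps)
  qed
  then obtain B where B: "B \<in> ?N" and gain: "\<rho> * a j / ?K \<le> \<gamma> * real (card (?D B)) - real (card (?S B))"
    by blast
  have aj0: "0 \<le> a j" by (simp add: a_def)
  have S: "real (card (?S B)) \<le> \<gamma> * real (card (?D B))"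
    using gain \<rho> aj0 K0 by (smt (verit) divide_nonneg_pos mult_nonneg_nonneg)
  have "\<rho> ^ ?r * (\<delta> * ?C / ?M) \<le> \<rho> ^ j * a 0"
  proof (rule mult_mono)
    show "\<rho> ^ ?r \<le> \<rho> ^ j" using j \<rho> by (intro power_decreasing) auto
    show "\<delta> * ?C / ?M \<le> a 0" using large by (simp add: a_def)
  qed (use \<rho> b0 in auto)
  also note aj
  also have "a j \<le> 2 * ?K * real (card (?D B))"
  proof -
    have "\<rho> * a j / ?K \<le> \<gamma> * real (card (?D B))" using gain by linarith
    then have "\<gamma> * a j \<le> \<gamma> * (2 * ?K * real (card (?D B)))"
      using K0 by (simp add: \<rho>_def field_simps)
    then show ?thesis using \<gamma> by simp
  qed
  finally have main: "\<rho> ^ ?r * (\<delta> * ?C / ?M) \<le> 2 * ?K * real (card (?D B))" .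
  have r0: "real ?r > 0" using N by (simp add: zero_less_binomial_iff)
  have "real (N choose (N - 2)) = real ?r" using N binomial_symmetric[of 2 N] by simp
  \<comment> \<open>Count \<open>N\<close>-sets by choosing \<open>N - 2\<close> of their vertices
    first and then the other two.\<close>
  then have ident: "?C = ?K * (real ((n - N + 2) choose 2) / real ?r)"
    using choose_swap[of "N - 2" N n] N r0
    by (simp add: field_simps Suc_diff_le numeral_2_eq_2)
  have "\<delta> / ?M * \<rho> ^ ?r / 2 * (real ((n - N + 2) choose 2) / real ?r) * ?K
      = \<rho> ^ ?r * (\<delta> * ?C / ?M) / 2"
    unfolding ident by (simp add: ac_simps)
  also have "\<dots> \<le> (2 * ?K * real (card (?D B))) / 2"
    using main by (rule divide_right_mono) simp
  also have "\<dots> = real (card (?D B)) * ?K" by simp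
  finally have "\<delta> / ?M * \<rho> ^ ?r / 2 * (real ((n - N + 2) choose 2) / real ?r) \<le> real (card (?D B))"
    using K0 mult_le_cancel_right_pos by blast
  then show thesis
    using that[OF x(1) Q q qQ B _ S] by (simp add: \<rho>_def)
qed

subsection \<open>Containers\<close>

definition shrink :: "template \<Rightarrow> nat set set \<Rightarrow> nat \<Rightarrow> template" where
  "shrink t F a = (\<lambda>e. if e \<in> F then t e - {a} else t e)"

text \<open>Unlike the entropy, this is a natural number that falls by one with each deleted colour,
  so it serves both for induction and as the exponent of the counting potential.\<close>

definition weight :: "nat \<Rightarrow> template \<Rightarrow> nat" where
  "weight n t = (\<Sum>e\<in>edges n. card (t e))"

lemma weight_shrink:
  assumes t: "t \<in> templates k n" and F: "F \<subseteq> edges n" "\<And>e. e \<in> F \<Longrightarrow> a \<in> t e"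
  shows "weight n (shrink t F a) + card F = weight n t"
proof -
  have "card (t e) = card (shrink t F a e) + (if e \<in> F then 1 else 0)" if "e \<in> edges n" for e
    using F(2)[of e] template_edge(3)[OF t that] by (auto simp: shrink_def card_Suc_Diff1 simp del: card_Diff_insert)
  then have "weight n t = (\<Sum>e\<in>edges n. card (shrink t F a e) + (if e \<in> F then 1 else 0))"
    unfolding weight_def by (rule sum.cong[OF refl])
  also have "\<dots> = weight n (shrink t F a) + (\<Sum>e\<in>edges n. if e \<in> F then 1 else 0)"
    by (simp add: sum.distrib weight_def)
  also have "(\<Sum>e\<in>edges n. if e \<in> F then 1 else 0) = card F"
    using F(1) by (simp add: sum.If_cases Int_absorb1)
  finally show ?thesis by simp
qed

text \<open>The colouring \<open>c\<close> itself witnesses that no colour list becomes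
  empty.\<close>

lemma realisation_shrink:
  assumes t: "t \<in> templates k n" and c: "c \<in> realisations k n t" and F: "F \<subseteq> edges n"
    and ne: "\<And>e. e \<in> F \<Longrightarrow> c e \<noteq> a"
  shows "shrink t F a \<in> templates k n" "c \<in> realisations k n (shrink t F a)"
proof -
  have ct: "c e \<in> shrink t F a e" if "e \<in> edges n" for e
    using c ne that by (auto simp: realisations_def shrink_def)
  then show "c \<in> realisations k n (shrink t F a)"
    using c by (simp add: realisations_def)
  show "shrink t F a \<in> templates k n"
    unfolding templates_def
  proof (rule PiE_I)
    fix e assume "e \<in> edges n"
    then show "shrink t F a e \<in> {S. S \<subseteq> {1..k} \<and> S \<noteq> {}}"
      using ct[of e] template_edge(1)[OF t, of e] by (auto simp: shrink_def)
  next
    fix e assume "e \<notin> edges n"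
    then show "shrink t F a e = undefined"
      using t F by (auto simp: shrink_def templates_def)
  qed
qed

text \<open>A tuple records \<open>x\<close>, \<open>Q\<close>, \<open>q\<close>, \<open>B\<close>
  and a colouring of only the edges meeting \<open>B\<close>. For fixed \<open>k\<close> and
  \<open>N\<close> this leaves exponentially many tuples in \<open>n\<close>, not in the square of
  \<open>n\<close>.\<close>

definition fingerprints ::
    "nat \<Rightarrow> nat \<Rightarrow> nat \<Rightarrow> (colouring \<times> nat set set \<times> nat set \<times> nat set \<times> colouring) set" where
  "fingerprints k N n =
     colourings k N \<times> Pow (edges N) \<times> edges N \<times>
     (SIGMA B:nsets {1..n} (N - 2). {e \<in> edges n. e \<inter> B \<noteq> {}} \<rightarrow>\<^sub>E {1..k})"

lemma finite_fingerprints: "finite (fingerprints k N n)"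
  unfolding fingerprints_def
  by (intro finite_cartesian_product finite_SigmaI) (auto intro!: finite_PiE simp: finite_imp_finite_nsets)

lemma card_edges_meeting:
  assumes "finite B"
  shows "card {e \<in> edges n. e \<inter> B \<noteq> {}} \<le> card B * n"
proof -
  have "{e \<in> edges n. e \<inter> B \<noteq> {}} \<subseteq> (\<lambda>(a, b). {a, b}) ` (B \<times> {1..n})"
    unfolding edges_def nsets_2_eq by (auto simp: doubleton_eq_iff image_iff)
  then have "card {e \<in> edges n. e \<inter> B \<noteq> {}} \<le> card (B \<times> {1..n})"
    using assms by (intro surj_card_le) auto
  then show ?thesis by (simp add: card_cartesian_product)
qed

lemma card_fingerprints:
  assumes "1 \<le> k"
  shows "card (fingerprints k N n) \<le>
    card (colourings k N) * 2 ^ (N choose 2) * (N choose 2) * (2 ^ n * k ^ (N * n))"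
proof -
  let ?N = "nsets {1..n} (N - 2)" and ?E = "\<lambda>B. {e \<in> edges n. e \<inter> B \<noteq> {}}"
  have "card (SIGMA B:?N. ?E B \<rightarrow>\<^sub>E {1..k}) = (\<Sum>B\<in>?N. card (?E B \<rightarrow>\<^sub>E {1..k}))"
    by (intro card_SigmaI) (auto simp: finite_imp_finite_nsets intro!: finite_PiE)
  also have "\<dots> = (\<Sum>B\<in>?N. k ^ card (?E B))"
    by (simp add: card_PiE)
  also have "\<dots> \<le> (\<Sum>B\<in>?N. k ^ (N * n))"
  proof (rule sum_mono)
    fix B assume B: "B \<in> ?N"
    have "card (?E B) \<le> card B * n"
      using nsetsD[OF B] by (intro card_edges_meeting) simp
    also have "\<dots> \<le> N * n" using nsetsD[OF B] by simp
    finally show "k ^ card (?E B) \<le> k ^ (N * n)" using assms by (intro power_increasing)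
  qed
  also have "\<dots> = card ?N * k ^ (N * n)" by simp
  also have "\<dots> \<le> 2 ^ n * k ^ (N * n)"
    using card_mono[of "Pow {1..n}" ?N] by (intro mult_right_mono) (auto simp: nsets_def card_Pow)
  finally have "card (SIGMA B:?N. ?E B \<rightarrow>\<^sub>E {1..k}) \<le> 2 ^ n * k ^ (N * n)" .
  then have "card (colourings k N) * 2 ^ (N choose 2) * (N choose 2) * card (SIGMA B:?N. ?E B \<rightarrow>\<^sub>E {1..k})
     \<le> card (colourings k N) * 2 ^ (N choose 2) * (N choose 2) * (2 ^ n * k ^ (N * n))"
    by (rule mult_left_mono) simp
  then show ?thesis
    by (simp add: fingerprints_def card_cartesian_product card_Pow mult.assoc)
qed

text \<open>With \<open>d\<close> the link size, the potential \<open>exp (\<mu> * weight)\<close>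
  loses a factor \<open>exp (\<mu> * d / 2)\<close> per child. The exceptional sets cost at most
  \<open>exp (\<mu> * d / 4)\<close> and the fingerprints at most
  \<open>exp (\<mu> * \<beta> / 4)\<close>; since \<open>\<beta> \<le> d\<close>, the total does not
  grow.\<close>

lemma refine_template:
  assumes oh: "order_hereditary k P" and t: "t \<in> templates k n" and N: "2 \<le> N" "N \<le> n"
    and \<delta>: "\<delta> > 0" and \<gamma>: "0 < \<gamma>" "\<gamma> \<le> 1/2" and \<mu>: "\<mu> > 0"
    and few: "\<And>D :: nat set set. finite D \<Longrightarrow>
       real (card {S. S \<subseteq> D \<and> real (card S) \<le> \<gamma> * real (card D)}) \<le> exp (\<mu>/4 * real (card D))"
    and bad: "real (card (bad_copies k P N n t)) > \<delta> * real (n choose N)"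
    and \<beta>: "\<beta> = \<delta> / real (card (colourings k N)) * (\<gamma>/2) ^ (N choose 2) / 2
                 * (real ((n - N + 2) choose 2) / real (N choose 2))" "\<beta> > 0"
    and fp: "real (card (fingerprints k N n)) \<le> exp (\<mu> * \<beta> / 4)"
  shows "\<exists>U\<subseteq>templates k n. (\<forall>u\<in>U. weight n u < weight n t) \<and>
     realisations k n t \<inter> P n \<subseteq> (\<Union>u\<in>U. realisations k n u \<inter> P n) \<and>
     (\<Sum>u\<in>U. exp (\<mu> * real (weight n u))) \<le> exp (\<mu> * real (weight n t))"
proof -
  define D where "D = (\<lambda>(x, Q, q, B, y). link N n t x Q q B y)"
  define a :: "colouring \<times> nat set set \<times> nat set \<times> nat set \<times> colouring \<Rightarrow> nat"
    where "a = (\<lambda>(x, Q, q, B, y). x q)"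
  define Z where "Z = {z \<in> fingerprints k N n. \<beta> \<le> real (card (D z))}"
  define \<S> where "\<S> z = {S. S \<subseteq> D z \<and> real (card S) \<le> \<gamma> * real (card (D z))}" for z
  define f where "f = (\<lambda>(z, S). shrink t (D z - S) (a z))"
  \<comment> \<open>Some pairs may empty a colour list; intersecting with
    \<open>templates k n\<close> discards them, and no \<open>c\<close> to be covered needs
    them.\<close>
  define U where "U = f ` Sigma Z \<S> \<inter> templates k n"
  have D: "finite (D z)" "D z \<subseteq> edges n" for z
    by (auto simp: D_def finite_link link_def split: prod.splits)
  have aD: "a z \<in> t e" if "z \<in> Z" "e \<in> D z" for z e
    using that link_colour by (fastforce simp: Z_def D_def a_def fingerprints_def)
  have fin: "finite Z" "finite (\<S> z)" for z
    using D(1) by (auto simp: Z_def \<S>_def finite_fingerprints)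
  have drop: "real (weight n (f (z, S))) \<le> real (weight n t) - real (card (D z)) / 2"
    and big: "\<beta> \<le> real (card (D z))" if "z \<in> Z" "S \<in> \<S> z" for z S
  proof -
    show "\<beta> \<le> real (card (D z))" using that by (simp add: Z_def)
    have S: "S \<subseteq> D z" "real (card S) \<le> \<gamma> * real (card (D z))" using that by (auto simp: \<S>_def)
    have "\<gamma> * real (card (D z)) \<le> 1/2 * real (card (D z))" using \<gamma> by (intro mult_right_mono) auto
    moreover have "card (D z - S) = card (D z) - card S" "card S \<le> card (D z)"
      using S(1) D(1)[of z] by (auto simp: card_Diff_subset finite_subset card_mono)
    moreover have "weight n (f (z, S)) + card (D z - S) = weight n t"
      unfolding f_def using D(2)[of z] aD[OF that(1)] by (auto intro!: weight_shrink[OF t])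
    ultimately show "real (weight n (f (z, S))) \<le> real (weight n t) - real (card (D z)) / 2"
      using S(2) by linarith
  qed
  have "U \<subseteq> templates k n" by (simp add: U_def)
  moreover have "\<forall>u\<in>U. weight n u < weight n t"
  proof
    fix u assume "u \<in> U"
    then obtain z S where "u = f (z, S)" "z \<in> Z" "S \<in> \<S> z" by (auto simp: U_def)
    then show "weight n u < weight n t" using drop[of z S] big[of z S] \<beta>(2) by simp
  qed
  moreover have "realisations k n t \<inter> P n \<subseteq> (\<Union>u\<in>U. realisations k n u \<inter> P n)"
  proof
    fix c assume c: "c \<in> realisations k n t \<inter> P n"
    then have cP: "c \<in> P n" and ct: "c \<in> realisations k n t" by auto
    obtain x Q q B where fp: "x \<in> colourings k N" "Q \<subseteq> edges N" "q \<in> edges N" "q \<notin> Q"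
      "B \<in> nsets {1..n} (N - 2)" and large: "\<beta> \<le> real (card (link N n t x Q q B c))"
      and small: "real (card {e \<in> link N n t x Q q B c. c e = x q}) \<le> \<gamma> * real (card (link N n t x Q q B c))"
      using fingerprint_exists[OF oh cP N \<delta> \<gamma> bad] unfolding \<beta>(1) by blast
    \<comment> \<open>This finite trace of \<open>c\<close> reconstructs the link through
      \<open>link_determined\<close>.\<close>
    define y where "y = restrict c {e \<in> edges n. e \<inter> B \<noteq> {}}"
    define z where "z = (x, Q, q, B, y)"
    define S where "S = {e \<in> link N n t x Q q B c. c e = x q}"
    have Dz: "D z = link N n t x Q q B c"
      using link_determined[OF fp(3,4,2)] by (simp add: D_def z_def y_def)
    have "y \<in> {e \<in> edges n. e \<inter> B \<noteq> {}} \<rightarrow>\<^sub>E {1..k}"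
      using ct by (auto simp: y_def realisations_def colourings_def)
    then have "z \<in> Z"
      using fp large Dz by (simp add: Z_def fingerprints_def) (simp add: z_def)
    moreover have "S \<in> \<S> z" using small Dz by (auto simp: \<S>_def S_def)
    moreover have "c e \<noteq> a z" if "e \<in> D z - S" for e
      using that Dz by (auto simp: S_def a_def z_def)
    then have "f (z, S) \<in> templates k n" "c \<in> realisations k n (f (z, S))"
      using realisation_shrink[OF t ct, of "D z - S" "a z"] D(2)[of z] by (auto simp: f_def)
    ultimately show "c \<in> (\<Union>u\<in>U. realisations k n u \<inter> P n)"
      using cP unfolding U_def by blast
  qed
  moreover have "(\<Sum>u\<in>U. exp (\<mu> * real (weight n u))) \<le> exp (\<mu> * real (weight n t))"
  proof -
    let ?w = "\<lambda>u. exp (\<mu> * real (weight n u))"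
    have "(\<Sum>u\<in>U. ?w u) \<le> (\<Sum>u\<in>f ` Sigma Z \<S>. ?w u)"
      using fin by (intro sum_mono2) (auto simp: U_def)
    \<comment> \<open>Different pairs may produce the same template, so this is only an
      inequality.\<close>
    also have "\<dots> \<le> (\<Sum>zS\<in>Sigma Z \<S>. ?w (f zS))"
      using sum_image_le[of "Sigma Z \<S>" ?w f] fin by (simp add: comp_def)
    also have "\<dots> = (\<Sum>z\<in>Z. \<Sum>S\<in>\<S> z. ?w (f (z, S)))"
      using fin by (subst sum.Sigma) auto
    also have "\<dots> \<le> (\<Sum>z\<in>Z. exp (\<mu> * real (weight n t)) * exp (- (\<mu> * \<beta> / 4)))"
    proof (rule sum_mono)
      fix z assume z: "z \<in> Z"
      let ?d = "real (card (D z))"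
      have d: "\<beta> \<le> ?d" using z by (simp add: Z_def)
      have "(\<Sum>S\<in>\<S> z. ?w (f (z, S))) \<le> (\<Sum>S\<in>\<S> z. exp (\<mu> * (real (weight n t) - ?d/2)))"
        using drop[OF z] \<mu> by (intro sum_mono) simp
      also have "\<dots> = real (card (\<S> z)) * exp (\<mu> * (real (weight n t) - ?d/2))" by simp
      also have "\<dots> \<le> exp (\<mu>/4 * ?d) * exp (\<mu> * (real (weight n t) - ?d/2))"
        using few[OF D(1)] by (intro mult_right_mono) (auto simp: \<S>_def)
      also have "\<dots> = exp (\<mu> * real (weight n t) - \<mu> * ?d / 4)"
        by (simp add: exp_add[symmetric] field_simps)
      also have "\<dots> \<le> exp (\<mu> * real (weight n t) - \<mu> * \<beta> / 4)"
        using \<mu> d by simp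
      also have "\<dots> = exp (\<mu> * real (weight n t)) * exp (- (\<mu> * \<beta> / 4))"
        by (simp add: exp_add[symmetric])
      finally show "(\<Sum>S\<in>\<S> z. ?w (f (z, S))) \<le> exp (\<mu> * real (weight n t)) * exp (- (\<mu> * \<beta> / 4))" .
    qed
    also have "\<dots> = real (card Z) * (exp (\<mu> * real (weight n t)) * exp (- (\<mu> * \<beta> / 4)))" by simp
    also have "\<dots> \<le> exp (\<mu> * \<beta> / 4) * (exp (\<mu> * real (weight n t)) * exp (- (\<mu> * \<beta> / 4)))"
    proof (rule mult_right_mono)
      have "card Z \<le> card (fingerprints k N n)"
        by (rule card_mono[OF finite_fingerprints]) (auto simp: Z_def)
      then show "real (card Z) \<le> exp (\<mu> * \<beta> / 4)" using fp by linarith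
    qed simp
    also have "\<dots> = exp (\<mu> * real (weight n t))"
      by (simp add: exp_minus)
    finally show ?thesis .
  qed
  ultimately show ?thesis by blast
qed

section \<open>Iteration of the refinement and size estimates\<close>

text \<open>Induction on the weight: the bounds of the children add up to at most that of the
  parent, and a good \<open>t\<close> forms a family of size 1, which is at most
  \<open>exp (\<mu> * W t)\<close>.\<close>

lemma iterate_refinement:
  fixes W :: "'t \<Rightarrow> nat" and R :: "'t \<Rightarrow> 'c set" and \<mu> :: real
  assumes X: "finite X" and \<mu>: "\<mu> \<ge> 0"
    and step: "\<And>t. t \<in> X \<Longrightarrow> \<not> good t \<Longrightarrow>
      \<exists>U\<subseteq>X. (\<forall>u\<in>U. W u < W t) \<and> R t \<subseteq> (\<Union>u\<in>U. R u) \<and>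
        (\<Sum>u\<in>U. exp (\<mu> * real (W u))) \<le> exp (\<mu> * real (W t))"
  shows "t \<in> X \<Longrightarrow> \<exists>T\<subseteq>X. (\<forall>u\<in>T. good u) \<and> R t \<subseteq> (\<Union>u\<in>T. R u) \<and>
      real (card T) \<le> exp (\<mu> * real (W t))"
proof (induction "W t" arbitrary: t rule: less_induct)
  case less
  show ?case
  proof (cases "good t")
    case True
    then show ?thesis using less.prems \<mu> by (intro exI[of _ "{t}"]) simp
  next
    case False
    obtain U where U: "U \<subseteq> X" "\<And>u. u \<in> U \<Longrightarrow> W u < W t" "R t \<subseteq> (\<Union>u\<in>U. R u)"
      "(\<Sum>u\<in>U. exp (\<mu> * real (W u))) \<le> exp (\<mu> * real (W t))"
      using step[OF less.prems False] by blast
    have "\<forall>u\<in>U. \<exists>T\<subseteq>X. (\<forall>u\<in>T. good u) \<and> R u \<subseteq> (\<Union>u\<in>T. R u) \<and>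
        real (card T) \<le> exp (\<mu> * real (W u))"
      using less.hyps U(1,2) by blast
    then obtain T where T: "\<And>u. u \<in> U \<Longrightarrow> T u \<subseteq> X \<and> (\<forall>v\<in>T u. good v) \<and>
        R u \<subseteq> (\<Union>v\<in>T u. R v) \<and> real (card (T u)) \<le> exp (\<mu> * real (W u))"
      by metis
    have "real (card (\<Union>u\<in>U. T u)) \<le> real (\<Sum>u\<in>U. card (T u))"
      using card_UN_le[of U T] X U(1) finite_subset of_nat_le_iff by blast
    also have "\<dots> \<le> (\<Sum>u\<in>U. exp (\<mu> * real (W u)))"
      using T by (simp add: sum_mono)
    also note U(4)
    finally have "real (card (\<Union>u\<in>U. T u)) \<le> exp (\<mu> * real (W t))" .
    moreover have "R t \<subseteq> (\<Union>v\<in>(\<Union>u\<in>U. T u). R v)" using U(3) T by fastforce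
    moreover have "(\<Union>u\<in>U. T u) \<subseteq> X" "\<forall>v\<in>(\<Union>u\<in>U. T u). good v" using T by auto
    ultimately show ?thesis by blast
  qed
qed

lemma linear_le_quadratic:
  fixes c d e :: real
  assumes "c > 0"
  shows "\<exists>n\<^sub>0. \<forall>n\<ge>n\<^sub>0. d + e * real n \<le> c * (real (n - N))\<^sup>2"
proof (intro exI allI impI)
  \<comment> \<open>\<open>n \<ge> 2 * N\<close> gives \<open>n - N \<ge> n/2\<close>, and the last
    bound absorbs both coefficients into \<open>c/4 * n\<close>, which matches
    \<open>c * (n/2)\<close> squared after multiplying by \<open>n\<close>.\<close>
  fix n assume n: "max (max 1 (2 * N)) (nat \<lceil>4 * (\<bar>d\<bar> + \<bar>e\<bar>) / c\<rceil>) \<le> n"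
  then have n1: "1 \<le> real n" and nN: "real n / 2 \<le> real (n - N)" by auto
  have "4 * (\<bar>d\<bar> + \<bar>e\<bar>) / c \<le> real n" using n by linarith
  then have big: "\<bar>d\<bar> + \<bar>e\<bar> \<le> c / 4 * real n" using assms by (simp add: field_simps)
  have "d + e * real n \<le> \<bar>d\<bar> * real n + \<bar>e\<bar> * real n"
    using mult_left_mono[OF n1, of "\<bar>d\<bar>"] mult_right_mono[of e "\<bar>e\<bar>" "real n"] by linarith
  also have "\<dots> \<le> (c / 4 * real n) * real n"
    using mult_right_mono[OF big, of "real n"] by (simp add: algebra_simps)
  also have "\<dots> = c * (real n / 2)\<^sup>2" by (simp add: power2_eq_square)
  also have "\<dots> \<le> c * (real (n - N))\<^sup>2"
    using nN assms by (intro mult_left_mono power_mono) auto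
  finally show "d + e * real n \<le> c * (real (n - N))\<^sup>2" .
qed

text \<open>The logarithm of the count is linear in \<open>n\<close>, the target exponent
  quadratic.\<close>

lemma fingerprints_negligible:
  assumes k: "1 \<le> k" and b: "b > 0" and N: "2 \<le> N"
  shows "\<exists>n\<^sub>0. \<forall>n\<ge>n\<^sub>0. real (card (fingerprints k N n)) \<le> exp (b * real ((n - N + 2) choose 2))"
proof -
  define C where "C = card (colourings k N) * 2 ^ (N choose 2) * (N choose 2)"
  have "card (colourings k N) = k ^ (N choose 2)"
    by (simp add: colourings_def card_PiE)
  then have C: "C > 0" using k N by (simp add: C_def zero_less_binomial_iff)
  obtain n0 where n0: "\<And>n. n \<ge> n0 \<Longrightarrow>
      ln (real C) + (ln 2 + real N * ln (real k)) * real n \<le> b/2 * (real (n - N))\<^sup>2"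
    using linear_le_quadratic[of "b/2" "ln (real C)" "ln 2 + real N * ln (real k)" N] b by auto
  show ?thesis
  proof (intro exI allI impI)
    fix n assume n: "n0 \<le> n"
    have "(n - N)\<^sup>2 \<le> (n - N + 2) * (n - N + 1)" by (simp add: power2_eq_square)
    also have "\<dots> = 2 * ((n - N + 2) choose 2)" by (simp add: choose_two)
    finally have "(real (n - N))\<^sup>2 \<le> 2 * real ((n - N + 2) choose 2)"
      by (metis of_nat_le_iff of_nat_mult of_nat_numeral of_nat_power)
    then have sq: "b/2 * (real (n - N))\<^sup>2 \<le> b * real ((n - N + 2) choose 2)"
      using mult_left_mono[of _ _ "b/2"] b by fastforce
    have "real (card (fingerprints k N n)) \<le> real (C * (2 ^ n * k ^ (N * n)))"
      using card_fingerprints[OF k] unfolding C_def of_nat_le_iff .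
    also have "\<dots> = exp (ln (real C)) * (exp (ln 2) ^ n * exp (ln (real k)) ^ (N * n))"
      using C k by simp
    also have "\<dots> = exp (ln (real C) + (ln 2 + real N * ln (real k)) * real n)"
      by (simp only: exp_of_nat_mult[symmetric] exp_add[symmetric]) (simp add: algebra_simps)
    also have "\<dots> \<le> exp (b * real ((n - N + 2) choose 2))"
      using n0[OF n] sq by simp
    finally show "real (card (fingerprints k N n)) \<le> exp (b * real ((n - N + 2) choose 2))" .
  qed
qed

lemma containers_exist:
  assumes k: "1 \<le> k" and oh: "order_hereditary k P" and N: "2 \<le> N" and \<delta>: "\<delta> > 0" and \<mu>: "\<mu> > 0"
  shows "\<exists>n\<^sub>0. \<forall>n\<ge>n\<^sub>0. \<exists>T. container_family k n P T \<and>
     (\<forall>t\<in>T. real (card (bad_copies k P N n t)) \<le> \<delta> * real (n choose N)) \<and>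
     real (card T) \<le> exp (\<mu> * (real k * real (n choose 2)))"
proof -
  obtain \<gamma> :: real where \<gamma>: "0 < \<gamma>" "\<gamma> \<le> 1/2" and few: "\<And>D :: nat set set. finite D \<Longrightarrow>
       real (card {S. S \<subseteq> D \<and> real (card S) \<le> \<gamma> * real (card D)}) \<le> exp (\<mu>/4 * real (card D))"
    using few_small_subsets[of "\<mu>/4"] \<mu> by auto
  let ?\<beta> = "\<lambda>n. \<delta> / real (card (colourings k N)) * (\<gamma>/2) ^ (N choose 2) / 2
                 * (real ((n - N + 2) choose 2) / real (N choose 2))"
  \<comment> \<open>Chosen so that \<open>b * ((n - N + 2) choose 2)\<close> is a quarter of \<mu>
    times the guaranteed link size. It is independent of \<open>n\<close>.\<close>
  define b where "b = \<mu> / 4 * (\<delta> / real (card (colourings k N)) * (\<gamma>/2) ^ (N choose 2) / 2 / real (N choose 2))"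
  have r0: "0 < real (N choose 2)" using N by (simp add: zero_less_binomial_iff)
  have "card (colourings k N) = k ^ (N choose 2)"
    by (simp add: colourings_def card_PiE)
  then have M0: "real (card (colourings k N)) > 0" using k by simp
  have "b > 0" unfolding b_def using r0 M0 \<mu> \<delta> \<gamma> by simp
  then obtain n0 where n0: "\<And>n. n \<ge> n0 \<Longrightarrow>
      real (card (fingerprints k N n)) \<le> exp (b * real ((n - N + 2) choose 2))"
    using fingerprints_negligible[OF k _ N] by blast
  show ?thesis
  proof (rule exI[of _ "max n0 N"], intro allI impI)
    fix n assume n: "max n0 N \<le> n"
    let ?good = "\<lambda>t. real (card (bad_copies k P N n t)) \<le> \<delta> * real (n choose N)"
    have "b * real ((n - N + 2) choose 2) = \<mu> * ?\<beta> n / 4" by (simp add: b_def)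
    then have fp: "real (card (fingerprints k N n)) \<le> exp (\<mu> * ?\<beta> n / 4)"
      using n0[of n] n by (simp only:)
    have \<beta>0: "?\<beta> n > 0" using r0 M0 \<delta> \<gamma> by (simp add: zero_less_binomial_iff)
    have Nn: "N \<le> n" using n by simp
    \<comment> \<open>The iteration starts from the template allowing every colour, whose weight
      gives the exponent of the final bound.\<close>
    define t where "t = restrict (\<lambda>e. {1..k}) (edges n)"
    have t: "t \<in> templates k n" using k by (auto simp: t_def templates_def)
    have R: "P n \<subseteq> realisations k n t \<inter> P n"
    proof
      fix c assume c: "c \<in> P n"
      then have "c \<in> colourings k n" using oh by (auto simp: order_hereditary_def)
      then show "c \<in> realisations k n t \<inter> P n"
        using c by (auto simp: realisations_def t_def colourings_def)
    qed
    have W: "real (weight n t) = real k * real (n choose 2)"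
      by (simp add: weight_def t_def)
    have "\<exists>T\<subseteq>templates k n. (\<forall>u\<in>T. ?good u) \<and>
        realisations k n t \<inter> P n \<subseteq> (\<Union>u\<in>T. realisations k n u \<inter> P n) \<and>
        real (card T) \<le> exp (\<mu> * real (weight n t))"
    proof (rule iterate_refinement[OF finite_templates _ _ t])
      show "\<mu> \<ge> 0" using \<mu> by simp
      fix u assume u: "u \<in> templates k n" and "\<not> ?good u"
      then have bad: "real (card (bad_copies k P N n u)) > \<delta> * real (n choose N)" by simp
      show "\<exists>U\<subseteq>templates k n. (\<forall>v\<in>U. weight n v < weight n u) \<and>
         realisations k n u \<inter> P n \<subseteq> (\<Union>v\<in>U. realisations k n v \<inter> P n) \<and>
         (\<Sum>v\<in>U. exp (\<mu> * real (weight n v))) \<le> exp (\<mu> * real (weight n u))"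
        by (rule refine_template[OF oh u N Nn \<delta> \<gamma> \<mu> few bad refl \<beta>0 fp])
    qed
    then obtain T where "T \<subseteq> templates k n" "\<forall>u\<in>T. ?good u"
      "realisations k n t \<inter> P n \<subseteq> (\<Union>u\<in>T. realisations k n u \<inter> P n)"
      "real (card T) \<le> exp (\<mu> * real (weight n t))"
      by blast
    then show "\<exists>T. container_family k n P T \<and> (\<forall>t\<in>T. ?good t) \<and>
        real (card T) \<le> exp (\<mu> * (real k * real (n choose 2)))"
      using R W unfolding container_family_def by (intro exI[of _ T]) auto
  qed
qed

theorem corollary2p14:
  fixes k m :: nat and P :: "nat \<Rightarrow> colouring set" and \<epsilon> :: real
  assumes "k \<ge> 2"
    and "order_hereditary k P"
    and "\<And>n. P n \<noteq> {}"
    and "\<epsilon> > 0"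
  shows "\<exists>n\<^sub>0. \<forall>n\<ge>n\<^sub>0. \<exists>T.
    T \<subseteq> templates k n \<and>
    container_family k n P T \<and>
    (\<forall>t\<in>T. Ent k n t \<le> (entropy_density k P + \<epsilon>) * real (n choose 2)) \<and>
    (\<forall>t\<in>T. \<forall>c\<in>realisations k n t.
       real (card {A \<in> nsets {1..n} m. restr c A \<notin> P m}) \<le> \<epsilon> * real (n choose m)) \<and>
    real (card T) \<le> real k powr (\<epsilon> * real (n choose 2))"
proof -
  note k = assms(1) and oh = assms(2) and ne = assms(3)
  \<comment> \<open>Half of \<epsilon> goes to the density at \<open>N\<close>, the other half to
    the share of bad \<open>N\<close>-sets.\<close>
  have "\<forall>\<^sub>F N in sequentially.
      extremal_entropy k N P / real (N choose 2) < entropy_density k P + \<epsilon>/2"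
    using order_tendstoD(2)[OF extremal_density_tendsto[OF k oh ne]] assms(4) by simp
  then obtain N0 where N0: "\<And>N. N \<ge> N0 \<Longrightarrow>
      extremal_entropy k N P / real (N choose 2) < entropy_density k P + \<epsilon>/2"
    by (auto simp: eventually_sequentially)
  define N where "N = max N0 (max m 2)"
  have N: "2 \<le> N" "m \<le> N" and dens: "extremal_entropy k N P / real (N choose 2) < entropy_density k P + \<epsilon>/2"
    using N0[of N] by (auto simp: N_def)
  \<comment> \<open>Turns \<open>exp (\<mu> * k * (n choose 2))\<close> into a power of
    \<open>k\<close> with exponent \<open>\<epsilon> * (n choose 2)\<close>.\<close>
  define \<mu> where "\<mu> = \<epsilon> * ln (real k) / real k"
  have \<mu>: "\<mu> > 0" "\<mu> * real k = \<epsilon> * ln (real k)" using k assms(4) by (auto simp: \<mu>_def)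
  have k1: "1 \<le> k" and \<delta>: "\<epsilon>/2 > 0" using k assms(4) by auto
  obtain n0 where n0: "\<And>n. n \<ge> n0 \<Longrightarrow> \<exists>T. container_family k n P T \<and>
     (\<forall>t\<in>T. real (card (bad_copies k P N n t)) \<le> \<epsilon>/2 * real (n choose N)) \<and>
     real (card T) \<le> exp (\<mu> * (real k * real (n choose 2)))"
    using containers_exist[OF k1 oh N(1) \<delta> \<mu>(1)] by blast
  show ?thesis
  proof (rule exI[of _ "max n0 N"], intro allI impI)
    fix n assume "max n0 N \<le> n"
    then have n: "n0 \<le> n" "N \<le> n" by auto
    obtain T where T: "container_family k n P T"
      and good: "\<And>t. t \<in> T \<Longrightarrow> real (card (bad_copies k P N n t)) \<le> \<epsilon>/2 * real (n choose N)"
      and card: "real (card T) \<le> exp (\<mu> * (real k * real (n choose 2)))"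
      using n0[OF n(1)] by blast
    have TT: "T \<subseteq> templates k n" using T by (simp add: container_family_def)
    have "Ent k n t \<le> (entropy_density k P + \<epsilon>) * real (n choose 2)" if t: "t \<in> T" for t
    proof -
      have P: "P N \<subseteq> colourings k N" using oh by (simp add: order_hereditary_def)
      have "Ent k n t \<le> (extremal_entropy k N P / real (N choose 2) + \<epsilon>/2) * real (n choose 2)"
        using Ent_averaging[of k P N t n "\<epsilon>/2"] k P ne TT t N n good[OF t] by blast
      also have "\<dots> \<le> (entropy_density k P + \<epsilon>) * real (n choose 2)"
        using dens by (intro mult_right_mono) auto
      finally show ?thesis .
    qed
    moreover have "real (card {A \<in> nsets {1..n} m. restr c A \<notin> P m}) \<le> \<epsilon> * real (n choose m)"
      if "t \<in> T" "c \<in> realisations k n t" for t c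
    proof -
      have "real (card {A \<in> nsets {1..n} m. restr c A \<notin> P m}) \<le> \<epsilon>/2 * real (n choose m)"
        by (rule card_bad_restr_le[OF oh N(2) n(2) that(2) good[OF that(1)]])
      also have "\<dots> \<le> \<epsilon> * real (n choose m)" using assms(4) by (intro mult_right_mono) auto
      finally show ?thesis .
    qed
    moreover have "real (card T) \<le> real k powr (\<epsilon> * real (n choose 2))"
    proof -
      have "\<mu> * (real k * real (n choose 2)) = \<epsilon> * real (n choose 2) * ln (real k)"
        using \<mu>(2) by (metis mult.assoc mult.commute)
      then show ?thesis using card k by (simp only: powr_def) simp
    qed
    ultimately show "\<exists>T. T \<subseteq> templates k n \<and> container_family k n P T \<and>
      (\<forall>t\<in>T. Ent k n t \<le> (entropy_density k P + \<epsilon>) * real (n choose 2)) \<and>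
      (\<forall>t\<in>T. \<forall>c\<in>realisations k n t.
         real (card {A \<in> nsets {1..n} m. restr c A \<notin> P m}) \<le> \<epsilon> * real (n choose m)) \<and>
      real (card T) \<le> real k powr (\<epsilon> * real (n choose 2))"
      using T TT by blast
  qed
qed

end
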